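(* Let $q$ be an odd prime power and $n\ge3$ with $(q^n-1)/2$ even, and let $Q=(q^n-1)/(q-1)$. Write $Q=k\,p_1\cdots p_s$ with $p_1,\dots,p_s$ distinct primes dividing $Q$ (and not dividing $k$), set $\delta=1-\sum_{i=1}^s1/p_i$, and assume $\delta>0$. Then $$\mathcal{N}_0(Q)\ >\ \delta\,\theta(k)\,q^{\frac n2}\Big\{q^{\frac n2-1}-2\Big(\frac{s-1}{\delta}+2\Big)W(k)\Big\}.$$ Hence, if $q^{\frac n2-1}>2\big(\frac{s-1}{\delta}+2\big)W(k)$, then $\mathcal{N}_0(q^n-1)>0$.
   Context: For a divisor $m$ of $q^n-1$, an element $\xi\in\mathbb{F}_{q^n}^*$ is $m$-free if $\xi=\zeta^d$ with $d\mid m$ and $\zeta\in\mathbb{F}_{q^n}^*$ implies $d=1$. $\mathcal{N}_0(m)$ is the number of $m$-free $\xi\in\mathbb{F}_{q^n}^*$ with $\mathrm{Tr}(\xi^2)=0$, where $\mathrm{Tr}(\xi)=\sum_{i=0}^{n-1}\xi^{q^i}$. $\theta(k)=\phi(k)/k$ and $W(t)$ is the number of square-free divisors of $t$. *)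

theory Defs
  imports Complex_Main "HOL-Library.Cardinality" "HOL-Number_Theory.Number_Theory"
    "HOL-Computational_Algebra.Squarefree"
begin

text \<open>The field with \<open>q ^ n\<close> elements is a type \<open>'a :: {field, finite}\<close> with
  \<open>CARD('a) = q ^ n\<close>.\<close>

definition m_free :: "nat \<Rightarrow> 'a::field \<Rightarrow> bool" where
  "m_free m x \<longleftrightarrow> x \<noteq> 0 \<and> (\<forall>d z. d dvd m \<longrightarrow> z \<noteq> 0 \<longrightarrow> x = z ^ d \<longrightarrow> d = 1)"

definition ff_trace :: "nat \<Rightarrow> nat \<Rightarrow> 'a::field \<Rightarrow> 'a" where
  "ff_trace q n x = (\<Sum>i<n. x ^ (q ^ i))"

definition N0 :: "'a::{field, finite} itself \<Rightarrow> nat \<Rightarrow> nat \<Rightarrow> nat \<Rightarrow> nat" where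
  "N0 _ q n m = card {x::'a. m_free m x \<and> ff_trace q n (x ^ 2) = 0}"

definition theta :: "nat \<Rightarrow> real" where
  "theta k = real (totient k) / real k"

definition W :: "nat \<Rightarrow> nat" where
  "W t = card {d. d dvd t \<and> squarefree d}"

end

theory Submission
  imports Defs "HOL-Computational_Algebra.Polynomial"
begin

text \<open>
  Write \<open>x = g ^ j\<close> with \<open>g\<close> a generator of the multiplicative group, \<open>N = q ^ n - 1\<close>, and let
  \<open>\<omega>\<close> be a primitive \<open>N\<close>-th root of unity, so that the multiplicative characters are
  \<open>g ^ j \<mapsto> \<omega> ^ (a * j)\<close>. The sum of a nontrivial character over the nonzero elements of trace \<open>0\<close>
  is bounded without additive characters: its squared modulus is the character sum of the
  autocorrelation \<open>t \<mapsto> card {u. u \<noteq> 0 \<and> Tr u = 0 \<and> Tr (g ^ t * u) = 0}\<close>, which takes only two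
  values, according to whether \<open>g ^ t\<close> lies in the subfield of order \<open>q\<close>. This gives the bound
  \<open>(1 - 1/q) q ^ (n/2)\<close>. A character whose order divides \<open>Q\<close> is a square \<open>\<chi>\<^sup>2\<close>, and its sum over
  \<open>Tr (x\<^sup>2) = 0\<close> is the sum of \<open>\<chi>\<close> plus that of \<open>\<chi>\<close> times the quadratic character over
  \<open>Tr x = 0\<close>, which doubles the bound.

  The condition that no prime of a set \<open>P\<close> divides \<open>j\<close> is imposed one prime at a time, replacing
  the indicator of \<open>p dvd j\<close> by the average of the \<open>p\<close> characters of order dividing \<open>p\<close>. Each prime
  multiplies the error by \<open>2 (1 - 1/p)\<close>, whence the factor \<open>\<theta>(k) W(k)\<close>. The primes \<open>p i\<close> are then
  removed by the union bound. Finally, multiplying a \<open>Q\<close>-free element by a suitable element of the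
  subfield makes it primitive and preserves \<open>Tr (x\<^sup>2) = 0\<close>.
\<close>

section \<open>Preliminaries on finite fields, periodic sums and prime factors\<close>

lemma finite_field_has_generator:
  "\<exists>g::'a::{field, finite}. \<forall>x. x \<noteq> 0 \<longleftrightarrow> (\<exists>i::nat. x = g ^ i)"
proof -
  \<comment> \<open>Viewing the type as a ring record makes the cyclicity of the multiplicative
    group of a finite field applicable.\<close>
  define R :: "'a ring" where
    "R = \<lparr>carrier = UNIV, monoid.mult = (*), one = 1, ring.zero = 0, add = (+)\<rparr>"
  have "\<exists>y. x + y = 0" for x :: 'a by (rule exI[of _ "- x"]) simp
  moreover have "\<exists>y. x * y = 1" if "x \<noteq> 0" for x :: 'a
    using that by (intro exI[of _ "inverse x"]) simp
  ultimately interpret R: Ring.field R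
    unfolding R_def by unfold_locales (auto simp: algebra_simps Units_def)
  have pow: "x [^]\<^bsub>R\<^esub> i = x ^ i" for x :: 'a and i :: nat
    by (induction i) (auto simp: R_def R.nat_pow_Suc mult.commute)
  have carrier: "carrier (mult_of R) = UNIV - {0}"
    by (simp add: R_def)
  have "finite (carrier R)" by (simp add: R_def)
  from R.finite_field_mult_group_has_gen[OF this]
  obtain g where g: "UNIV - {0::'a} = {g ^ i | i::nat. i \<in> UNIV}"
    unfolding carrier pow by blast
  have "x \<noteq> 0 \<longleftrightarrow> (\<exists>i::nat. x = g ^ i)" for x
    using arg_cong[OF g, of "\<lambda>A. x \<in> A"] by simp
  then show ?thesis by (intro exI[of _ g] allI)
qed

text \<open>The first isomorphism theorem by counting: translation by a point of a fibre carries
  that fibre onto the kernel. The domain is a subset \<open>H\<close> so that it can also be the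
  kernel of the trace.\<close>

lemma card_eq_card_image_times_card_kernel:
  fixes f :: "'a::ab_group_add \<Rightarrow> 'b::ab_group_add"
  assumes fin: "finite H"
    and closed: "\<And>x y. x \<in> H \<Longrightarrow> y \<in> H \<Longrightarrow> x + y \<in> H" "\<And>x y. x \<in> H \<Longrightarrow> y \<in> H \<Longrightarrow> x - y \<in> H"
    and add: "\<And>x y. x \<in> H \<Longrightarrow> y \<in> H \<Longrightarrow> f (x + y) = f x + f y"
  shows "card H = card (f ` H) * card {x \<in> H. f x = 0}"
proof -
  have fibre: "card {x \<in> H. f x = y} = card {x \<in> H. f x = 0}" if "y \<in> f ` H" for y
  proof -
    from that obtain z where z: "z \<in> H" "f z = y" by auto
    have diff: "f (x - z) = f x - f z" if "x \<in> H" for x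
      using add[OF closed(2)[OF that z(1)] z(1)] by (simp add: algebra_simps)
    have "bij_betw (\<lambda>x. x - z) {x \<in> H. f x = y} {x \<in> H. f x = 0}"
      by (rule bij_betwI[where g = "\<lambda>x. x + z"]) (use z closed diff add in auto)
    then show ?thesis by (rule bij_betw_same_card)
  qed
  have "card H = (\<Sum>y\<in>f ` H. card {x \<in> H. f x = y})"
    using sum.group[OF fin finite_imageI[OF fin] subset_refl, of "\<lambda>_. 1::nat" f] by simp
  also have "\<dots> = card (f ` H) * card {x \<in> H. f x = 0}"
    using fibre by simp
  finally show ?thesis .
qed

lemma prime_power_CARD_imp_CHAR:
  assumes "prime r" "CARD('a::{field, finite}) = r ^ m"
  shows "CHAR('a) = r"
proof -
  have "prime (CHAR('a))"
    by (rule prime_CHAR_semidom[OF finite_imp_CHAR_pos]) simp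
  moreover have "CHAR('a) dvd r ^ m"
    using CHAR_dvd_CARD[where 'a='a] assms by simp
  ultimately show ?thesis
    using assms(1) by (metis prime_dvd_power primes_dvd_imp_eq)
qed

lemma sum_of_bool:
  "finite A \<Longrightarrow> (\<Sum>j\<in>A. of_bool (P j) :: 'b::semiring_1) = of_nat (card {j \<in> A. P j})"
  by (simp add: sum.If_cases of_bool_def Int_def)

lemma periodic_sum_shift:
  fixes F :: "nat \<Rightarrow> 'b::ab_group_add"
  assumes "\<And>j. F (j + m) = F j"
  shows "(\<Sum>j<m. F (j + t)) = (\<Sum>j<m. F j)"
proof (induction t)
  case (Suc t)
  have "F t + (\<Sum>j<m. F (Suc j + t)) = (\<Sum>j<m. F (j + t)) + F (m + t)"
    using sum.lessThan_Suc_shift[of "\<lambda>j. F (j + t)" m] by simp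
  also have "F (m + t) = F t" using assms[of t] by (simp add: add.commute)
  finally show ?case using Suc by simp
qed simp

lemma sum_even_terms:
  fixes F :: "nat \<Rightarrow> 'b::comm_ring_1"
  shows "(\<Sum>j<2 * m. F j) + (\<Sum>j<2 * m. (- 1) ^ j * F j) = 2 * (\<Sum>j<m. F (2 * j))"
  by (induction m) (simp_all add: algebra_simps)

text \<open>Over one period \<open>2 * j\<close> meets every even residue twice, and
  \<open>1 + (- 1) ^ j\<close> is twice the indicator of even \<open>j\<close>. The sign will become
  the quadratic character.\<close>

lemma sum_even_terms_periodic:
  fixes F :: "nat \<Rightarrow> 'b::comm_ring_1"
  assumes "\<And>j. F (j + 2 * m) = F j"
  shows "(\<Sum>j<2 * m. F (2 * j)) = (\<Sum>j<2 * m. F j) + (\<Sum>j<2 * m. (- 1) ^ j * F j)"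
proof -
  have "(\<Sum>j<2 * m. F j) + (\<Sum>j<2 * m. (- 1) ^ j * F j) = 2 * (\<Sum>j<m. F (2 * j))"
    by (rule sum_even_terms)
  also have "2 * (\<Sum>j<m. F (2 * j)) = (\<Sum>j<m. F (2 * j)) + (\<Sum>j<m. F (2 * (j + m)))"
  proof -
    have "F (2 * (j + m)) = F (2 * j)" for j using assms[of "2 * j"] by (simp only: distrib_left)
    then show ?thesis by (simp only: mult_2)
  qed
  also have "\<dots> = (\<Sum>j<2 * m. F (2 * j))"
  proof -
    have "(\<Sum>j<m + k. F (2 * j)) = (\<Sum>j<m. F (2 * j)) + (\<Sum>j<k. F (2 * (j + m)))" for k
      by (induction k) (simp_all add: algebra_simps)
    from this[of m] show ?thesis by (simp only: mult_2)
  qed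
  finally show ?thesis ..
qed

text \<open>Distinct sets of prime factors have distinct products, and each product is a squarefree
  divisor of \<open>k\<close>.\<close>

lemma card_prime_factors_le_W:
  assumes "k > 0"
  shows "2 ^ card (prime_factors k) \<le> W k"
proof -
  have dvd_prod_iff: "p dvd \<Prod>S \<longleftrightarrow> p \<in> S"
    if "S \<subseteq> prime_factors k" "prime p" for S and p :: nat
  proof -
    have "finite S" using that(1) by (rule finite_subset) simp
    then have "p dvd \<Prod>S \<longleftrightarrow> (\<exists>r\<in>S. p dvd r)" using that(2) by (rule prime_dvd_prod_iff)
    also have "\<dots> \<longleftrightarrow> p \<in> S"
      using that primes_dvd_imp_eq[of p] by (metis dvd_refl in_prime_factors_imp_prime subsetD)
    finally show ?thesis .
  qed
  have "inj_on (\<lambda>S. \<Prod>S) (Pow (prime_factors k))"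
  proof (rule inj_onI)
    fix S T assume ST: "S \<in> Pow (prime_factors k)" "T \<in> Pow (prime_factors k)" "\<Prod>S = \<Prod>T"
    show "S = T"
    proof (rule Set.set_eqI)
      fix p show "p \<in> S \<longleftrightarrow> p \<in> T"
        using ST dvd_prod_iff[of S p] dvd_prod_iff[of T p] by (cases "prime p") auto
    qed
  qed
  moreover have "\<Prod>S dvd k \<and> squarefree (\<Prod>S)" if S: "S \<in> Pow (prime_factors k)" for S
  proof
    have "\<Prod>S dvd \<Prod>(prime_factors k)" using S by (intro prod_dvd_prod_subset) auto
    also have "\<dots> dvd (\<Prod>p\<in>prime_factors k. p ^ multiplicity p k)"
      by (intro prod_dvd_prod dvd_power) (auto simp: prime_factors_multiplicity)
    also have "\<dots> = k" using prime_factorization_nat[OF assms] by simp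
    finally show "\<Prod>S dvd k" .
    show "squarefree (\<Prod>S)"
      using S by (intro squarefree_prod_coprime) (auto intro!: primes_coprime squarefree_prime)
  qed
  ultimately have "card (Pow (prime_factors k)) \<le> card {d. d dvd k \<and> squarefree d}"
    using assms by (intro card_inj_on_le) auto
  then show ?thesis by (simp add: W_def card_Pow)
qed

lemma coprime_iff_prime_factors:
  fixes j m :: nat
  assumes "m > 0"
  shows "coprime j m \<longleftrightarrow> (\<forall>p\<in>prime_factors m. \<not> p dvd j)"
proof
  assume "coprime j m"
  show "\<forall>p\<in>prime_factors m. \<not> p dvd j"
  proof (intro ballI notI)
    fix p assume p: "p \<in> prime_factors m" "p dvd j"
    then have "p dvd m" by blast
    with p(2) have "is_unit p" by (rule coprime_common_divisor[OF \<open>coprime j m\<close>])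
    moreover have "prime p" using p(1) by (rule in_prime_factors_imp_prime)
    ultimately show False by simp
  qed
next
  assume *: "\<forall>p\<in>prime_factors m. \<not> p dvd j"
  show "coprime j m"
  proof (rule ccontr)
    assume "\<not> coprime j m"
    then have "gcd j m \<noteq> 1" by (simp only: coprime_iff_gcd_eq_1 not_False_eq_True)
    then obtain p where p: "prime p" "p dvd gcd j m" using prime_factor_nat by blast
    then have "p \<in> prime_factors m" using assms by (simp add: in_prime_factors_iff)
    with * p(2) show False by simp
  qed
qed

lemma exists_coprime_shift:
  fixes j M m :: nat
  assumes "coprime j M" "m > 0"
  shows "\<exists>i. coprime (j + M * i) m"
proof -
  \<comment> \<open>The shift by \<open>M * \<Prod>A\<close> keeps \<open>j\<close> nonzero modulo the primes in \<open>A\<close> and moves it off \<open>0\<close> modulo the others.\<close>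
  define A where "A = {p \<in> prime_factors m. \<not> p dvd j}"
  have "\<not> p dvd j + M * \<Prod>A" if p: "p \<in> prime_factors m" for p
  proof (cases "p dvd j")
    case True
    have "prime p" using p by auto
    moreover have "\<not> p dvd M" using True assms(1) \<open>prime p\<close> coprime_common_divisor_nat not_prime_1 by metis
    moreover have "\<not> p dvd \<Prod>A"
    proof
      assume "p dvd \<Prod>A"
      then obtain r where "r \<in> A" "p dvd r"
        using \<open>prime p\<close> by (auto simp: prime_dvd_prod_iff A_def)
      then show False using True \<open>prime p\<close> primes_dvd_imp_eq by (auto simp: A_def)
    qed
    ultimately show ?thesis using True by (simp add: dvd_add_right_iff prime_dvd_mult_iff)
  next
    case False
    then have "p dvd \<Prod>A" using p by (intro dvd_prodI) (auto simp: A_def)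
    then show ?thesis using False by (simp add: dvd_add_left_iff)
  qed
  then show ?thesis using coprime_iff_prime_factors[OF assms(2)] by blast
qed

section \<open>The trace form of a finite field\<close>

locale finite_field_generator =
  fixes g :: "'a::{field, finite}" and q n :: nat
  assumes q_primepow: "primepow q" and q_odd: "odd q" and n_ge2: "n \<ge> 2"
    and card_field: "CARD('a) = q ^ n"
    and generator: "\<And>x. x \<noteq> 0 \<longleftrightarrow> (\<exists>i::nat. x = g ^ i)"
begin

abbreviation Tr :: "'a \<Rightarrow> 'a" where "Tr \<equiv> ff_trace q n"

definition N :: nat where "N = q ^ n - 1"

definition Q :: nat where "Q = N div (q - 1)"

text \<open>The subfield of order \<open>q\<close>, as the fixed points of the Frobenius
  map.\<close>

definition K :: "'a set" where "K = {c. c ^ q = c}"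

lemma q_ge3: "q \<ge> 3"
proof -
  have "q > 1" using q_primepow by (rule primepow_gt_Suc_0[unfolded One_nat_def[symmetric]])
  then show ?thesis using q_odd by (cases "q = 2") auto
qed

lemma q_power_gt_1: "q ^ n > 1"
  using q_ge3 n_ge2 by (intro one_less_power) auto

lemma N_pos: "N > 0"
  using q_power_gt_1 by (simp add: N_def)

lemma N_eq: "N = Q * (q - 1)"
proof -
  have "int q - 1 dvd int q ^ n - 1"
    using power_diff_1_eq[of "int q" n] by simp
  then have "int (q - 1) dvd int N"
    using q_ge3 q_power_gt_1 by (simp add: N_def of_nat_diff)
  then show ?thesis by (simp add: Q_def)
qed

lemma Q_pos: "Q > 0" using N_pos N_eq by (cases Q) auto

lemma even_N: "even N" using q_odd by (simp add: N_def)

lemma power_card [simp]: "(x::'a) ^ (q ^ n) = x"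
proof -
  have "x * x ^ (CARD('a) - 1) = x" if "x \<noteq> 0"
  proof -
    \<comment> \<open>Multiplication by \<open>x\<close> permutes the nonzero elements.\<close>
    have "(\<Prod>y\<in>UNIV-{0}. x * y) = (\<Prod>y\<in>UNIV-{0}. y)"
      by (rule prod.reindex_bij_witness[of _ "\<lambda>y. y / x" "\<lambda>y. x * y"]) (use that in auto)
    then have "x ^ (CARD('a) - 1) * \<Prod>(UNIV-{0::'a}) = \<Prod>(UNIV-{0})"
      by (simp add: prod.distrib)
    then show ?thesis by simp
  qed
  moreover have "q ^ n = Suc (CARD('a) - 1)" using q_power_gt_1 card_field by simp
  ultimately show ?thesis by (cases "x = 0") (metis power_0_Suc, metis power_Suc)
qed

lemma g_nonzero [simp]: "g \<noteq> 0" using generator[of g] power_one_right[of g] by metis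

lemma g_power_N: "g ^ N = 1"
proof -
  have "Suc N = q ^ n" using q_power_gt_1 by (simp add: N_def)
  then have "g * g ^ N = g ^ (q ^ n)" by (metis power_Suc)
  then show ?thesis by simp
qed

lemma g_power_mod: "g ^ (i mod N) = g ^ i"
proof -
  have "g ^ i = g ^ (N * (i div N) + i mod N)" by simp
  also have "\<dots> = g ^ (i mod N)" by (simp only: power_add power_mult g_power_N) simp
  finally show ?thesis ..
qed

lemma bij_betw_g_power: "bij_betw (\<lambda>i. g ^ i) {..<N} (UNIV - {0})"
proof -
  have "(\<lambda>i. g ^ i) ` {..<N} = UNIV - {0}"
  proof (intro equalityI subsetI)
    fix x assume "x \<in> UNIV - {0::'a}"
    then obtain i where "x = g ^ i" using generator by auto
    then have "x = g ^ (i mod N)" by (simp add: g_power_mod)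
    then show "x \<in> (\<lambda>i. g ^ i) ` {..<N}" using N_pos by auto
  qed auto
  moreover from this have "inj_on (\<lambda>i. g ^ i) {..<N}"
    by (intro eq_card_imp_inj_on) (simp_all add: card_field N_def)
  ultimately show ?thesis by (simp add: bij_betw_def)
qed

lemma g_power_eq_iff: "g ^ i = g ^ j \<longleftrightarrow> [i = j] (mod N)"
proof -
  have "g ^ i = g ^ j \<longleftrightarrow> g ^ (i mod N) = g ^ (j mod N)" by (simp add: g_power_mod)
  also have "\<dots> \<longleftrightarrow> i mod N = j mod N"
    using bij_betw_g_power N_pos by (auto simp: bij_betw_def inj_on_def)
  finally show ?thesis by (simp add: cong_def)
qed

text \<open>The Frobenius map fixes \<open>g ^ i\<close> iff \<open>N dvd i * (q - 1)\<close>, and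
  \<open>N = Q * (q - 1)\<close>. So the nonzero elements of \<open>K\<close> are the powers of
  \<open>g ^ Q\<close>.\<close>

lemma g_power_in_K_iff: "g ^ i \<in> K \<longleftrightarrow> Q dvd i"
proof -
  have "i * q = i + i * (q - 1)" using q_ge3 by (simp add: algebra_simps)
  then have "g ^ i \<in> K \<longleftrightarrow> [i + i * (q - 1) = i + 0] (mod N)"
    unfolding K_def by (simp add: g_power_eq_iff flip: power_mult)
  also have "\<dots> \<longleftrightarrow> N dvd i * (q - 1)"
    by (simp only: cong_add_lcancel_nat cong_0_iff)
  also have "\<dots> \<longleftrightarrow> Q dvd i" using q_ge3 by (simp add: N_eq)
  finally show ?thesis .
qed

lemma multiples_of_Q: "{i. i < N \<and> Q dvd i} = (\<lambda>b. Q * b) ` {..<q - 1}"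
  using Q_pos by (auto simp: N_eq dvd_def)

lemma card_multiples_of_Q: "card {i. i < N \<and> Q dvd i} = q - 1"
  unfolding multiples_of_Q using Q_pos by (subst card_image) (auto simp: inj_on_def)

lemma card_K: "card K = q"
proof -
  have K: "K = insert 0 ((\<lambda>i. g ^ i) ` {i. i < N \<and> Q dvd i})"
  proof (intro equalityI subsetI)
    fix x assume x: "x \<in> K"
    show "x \<in> insert 0 ((\<lambda>i. g ^ i) ` {i. i < N \<and> Q dvd i})"
    proof (cases "x = 0")
      case False
      then obtain i where i: "i < N" "x = g ^ i"
        using bij_betw_g_power by (auto simp: bij_betw_def)
      then show ?thesis using x g_power_in_K_iff by blast
    qed auto
  next
    have "0 \<in> K" using q_ge3 by (simp add: K_def)
    then show "x \<in> K" if "x \<in> insert 0 ((\<lambda>i. g ^ i) ` {i. i < N \<and> Q dvd i})" for x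
      using that g_power_in_K_iff by blast
  qed
  have "inj_on (\<lambda>i. g ^ i) {..<N}"
    using bij_betw_g_power by (simp add: bij_betw_def)
  then have "inj_on (\<lambda>i. g ^ i) {i. i < N \<and> Q dvd i}" by (rule inj_on_subset) auto
  then have "card ((\<lambda>i. g ^ i) ` {i. i < N \<and> Q dvd i}) = q - 1"
    by (simp add: card_image card_multiples_of_Q)
  moreover have "0 \<notin> (\<lambda>i. g ^ i) ` {i. i < N \<and> Q dvd i}" by auto
  ultimately show ?thesis
    unfolding K using q_ge3 by (subst card_insert_disjoint) auto
qed

lemma frobenius_add: "((x::'a) + y) ^ (q ^ i) = x ^ (q ^ i) + y ^ (q ^ i)"
proof -
  obtain r e where r: "prime r" "q = r ^ e"
    using q_primepow by (auto simp: primepow_def)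
  have char: "CHAR('a) = r"
    by (rule prime_power_CARD_imp_CHAR[of r "e * n"]) (use r card_field in \<open>auto simp: power_mult\<close>)
  show ?thesis
    by (rule freshmans_dream'[of _ "e * i"]) (use char r in \<open>auto simp: power_mult\<close>)
qed

lemma Tr_add: "Tr (x + y) = Tr x + Tr y"
  by (simp add: ff_trace_def frobenius_add sum.distrib)

lemma Tr_0 [simp]: "Tr 0 = 0"
  using q_ge3 by (simp add: ff_trace_def power_0_left)

lemma Tr_diff: "Tr (x - y) = Tr x - Tr y"
  using Tr_add[of "x - y" y] by (simp add: algebra_simps)

lemma K_power: "c \<in> K \<Longrightarrow> c ^ (q ^ i) = c"
  by (induction i) (simp_all add: K_def power_mult)

lemma Tr_scale: "c \<in> K \<Longrightarrow> Tr (c * x) = c * Tr x"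
  by (simp add: ff_trace_def power_mult_distrib K_power sum_distrib_left)

lemma Tr_in_K: "Tr x \<in> K"
proof -
  have frob: "(\<Sum>i\<in>I. f i) ^ q = (\<Sum>i\<in>I. f i ^ q)" if "finite I" for I :: "nat set" and f :: "nat \<Rightarrow> 'a"
    using that q_ge3 frobenius_add[of _ _ 1] by (induction rule: finite_induct) auto
  have "(Tr x) ^ q = (\<Sum>i<n. x ^ (q ^ Suc i))"
    by (simp add: ff_trace_def frob mult.commute flip: power_mult)
  \<comment> \<open>The Frobenius map shifts the conjugates of \<open>x\<close>; adding
    \<open>x\<close> gives a list of \<open>n + 1\<close> conjugates, the last being
    \<open>x ^ (q ^ n) = x\<close>.\<close>
  also have "x + \<dots> = (\<Sum>i<Suc n. x ^ (q ^ i))"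
    by (subst sum.lessThan_Suc_shift) simp
  also have "\<dots> = x + Tr x" by (simp add: ff_trace_def)
  finally show ?thesis by (simp add: K_def)
qed

text \<open>The kernel consists of the roots of a polynomial of degree at most
  \<open>q ^ (n - 1)\<close>, nonzero because the exponents \<open>q ^ i\<close> are
  distinct.\<close>

lemma card_kernel_Tr_le: "card {x. Tr x = 0} \<le> q ^ (n - 1)"
proof -
  define P :: "'a poly" where "P = (\<Sum>i<n. monom 1 (q ^ i))"
  have coeff: "coeff P (q ^ (n - 1)) = 1"
  proof -
    have "coeff P (q ^ (n - 1)) = (\<Sum>i<n. if i = n - 1 then 1 else 0)"
      unfolding P_def coeff_sum using q_ge3 by (intro sum.cong) auto
    then show ?thesis using n_ge2 by simp
  qed
  have "degree P \<le> q ^ (n - 1)"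
    unfolding P_def using q_ge3
    by (intro degree_sum_le) (auto intro!: order.trans[OF degree_monom_le] power_increasing)
  moreover have "P \<noteq> 0" using coeff by auto
  then have "card {x. poly P x = 0} \<le> degree P" by (rule card_poly_roots_bound)
  moreover have "poly P x = Tr x" for x
    by (simp add: P_def ff_trace_def poly_sum poly_monom)
  ultimately show ?thesis by simp
qed

lemma q_power_n: "q ^ n = q * q ^ (n - 1)" "q ^ (n - 1) = q * q ^ (n - 2)"
proof -
  obtain m where "n = Suc (Suc m)" using n_ge2 by (metis le_iff_add add_2_eq_Suc)
  then show "q ^ n = q * q ^ (n - 1)" "q ^ (n - 1) = q * q ^ (n - 2)" by simp_all
qed

text \<open>The image has at most \<open>q\<close> elements and the kernel at most
  \<open>q ^ (n - 1)\<close>; the product of the sizes is \<open>q ^ n\<close>, so both bounds are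
  attained.\<close>

lemma Tr_range_and_kernel: "range Tr = K" "card {x. Tr x = 0} = q ^ (n - 1)"
proof -
  have sub: "range Tr \<subseteq> K" using Tr_in_K by auto
  then have le: "card (range Tr) \<le> q" using card_mono[of K "range Tr"] card_K by simp
  have eq: "q * q ^ (n - 1) = card (range Tr) * card {x. Tr x = 0}"
    using card_eq_card_image_times_card_kernel[of UNIV Tr] Tr_add card_field q_power_n by simp
  have ker: "card {x. Tr x = 0} \<ge> q ^ (n - 1)"
  proof -
    have "q * q ^ (n - 1) \<le> q * card {x. Tr x = 0}"
      unfolding eq by (rule mult_le_mono1[OF le])
    then show ?thesis using q_ge3 by (subst (asm) mult_le_cancel1) auto
  qed
  then show "card {x. Tr x = 0} = q ^ (n - 1)" using card_kernel_Tr_le by simp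
  with eq have "card (range Tr) = card K" using q_ge3 card_K by simp
  with sub show "range Tr = K" by (intro card_subset_eq) auto
qed

text \<open>The form \<open>u \<mapsto> Tr (t * u)\<close> is \<open>K\<close>-linear and does not
  vanish identically on the kernel of \<open>Tr\<close>. Hence it maps that kernel onto
  \<open>K\<close>, with fibres of equal size.\<close>

lemma card_common_kernel:
  assumes t: "t \<notin> K"
  shows "card {u. Tr u = 0 \<and> Tr (t * u) = 0} = q ^ (n - 2)"
proof -
  define H where "H = {u. Tr u = 0}"
  have "1 \<in> range Tr" unfolding Tr_range_and_kernel(1) by (simp add: K_def)
  then obtain u0 where u0: "Tr u0 = 1" by (metis imageE)
  \<comment> \<open>Otherwise \<open>u \<mapsto> Tr (t * u)\<close> factors through \<open>Tr\<close>, hence is \<open>u \<mapsto> Tr (c * u)\<close> with \<open>c\<close> in \<open>K\<close>.\<close>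
  have "\<exists>u\<in>H. Tr (t * u) \<noteq> 0"
  proof (rule ccontr)
    assume *: "\<not> ?thesis"
    define c where "c = Tr (t * u0)"
    have c: "c \<in> K" by (simp add: c_def Tr_in_K)
    have "Tr ((t - c) * u) = 0" for u
    proof -
      have "u - Tr u * u0 \<in> H"
        by (simp add: H_def Tr_diff Tr_scale Tr_in_K u0)
      with * have "Tr (t * (u - Tr u * u0)) = 0" by auto
      moreover have "t * (u - Tr u * u0) = t * u - Tr u * (t * u0)" by (simp add: algebra_simps)
      ultimately have "Tr (t * u) = Tr u * c" by (simp add: Tr_diff Tr_scale Tr_in_K c_def)
      moreover have "Tr (c * u) = c * Tr u" using c by (rule Tr_scale)
      ultimately show ?thesis by (simp add: algebra_simps Tr_diff)
    qed
    \<comment> \<open>If \<open>t\<close> differed from \<open>c\<close>, this \<open>u\<close>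
      would give \<open>(t - c) * u = u0\<close>, of trace 1.\<close>
    from this[of "u0 / (t - c)"] have "t = c" using u0 by (cases "t = c") auto
    then show False using t c by simp
  qed
  then obtain u1 where u1: "u1 \<in> H" "Tr (t * u1) \<noteq> 0" by auto
  have "(\<lambda>u. Tr (t * u)) ` H = K"
  proof (intro equalityI subsetI)
    fix c assume c: "c \<in> K"
    define d where "d = c / Tr (t * u1)"
    have d: "d \<in> K" using c Tr_in_K[of "t * u1"] by (simp add: d_def K_def power_divide)
    have "d * u1 \<in> H" using u1 d by (simp add: H_def Tr_scale)
    moreover have "Tr (t * (d * u1)) = c"
      using Tr_scale[OF d, of "t * u1"] u1 by (simp add: d_def mult_ac)
    ultimately show "c \<in> (\<lambda>u. Tr (t * u)) ` H" by force
  qed (auto simp: Tr_in_K)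
  moreover have "card H = card ((\<lambda>u. Tr (t * u)) ` H) * card {u \<in> H. Tr (t * u) = 0}"
    by (rule card_eq_card_image_times_card_kernel)
       (auto simp: H_def Tr_add Tr_diff algebra_simps)
  moreover have "card H = q * q ^ (n - 2)"
    using Tr_range_and_kernel(2) q_power_n(2) by (simp only: H_def)
  ultimately show ?thesis using q_ge3 card_K by (simp add: H_def)
qed

section \<open>Character sums over elements of trace zero\<close>

definition \<omega> :: complex where "\<omega> = cis (2 * pi / real N)"

lemma \<omega>_power_eq_1_iff: "\<omega> ^ a = 1 \<longleftrightarrow> N dvd a"
proof -
  have "\<omega> ^ a = 1 \<longleftrightarrow> (\<exists>k::int. 2 * pi * (real a / real N) = 2 * pi * of_int k)"
  proof -
    have "\<omega> ^ a = cis (2 * pi * (real a / real N))" by (simp add: \<omega>_def DeMoivre mult_ac)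
    moreover have "cis x = 1 \<longleftrightarrow> cos x = 1" for x
      using cos_one_sin_zero[of x] by (auto simp: complex_eq_iff)
    ultimately show ?thesis by (simp add: cos_one_2pi_int mult_ac)
  qed
  also have "\<dots> \<longleftrightarrow> (\<exists>k::int. real a = real N * of_int k)"
    using N_pos by (auto simp: field_simps)
  also have "\<dots> \<longleftrightarrow> (\<exists>k::int. int a = int N * k)"
  proof -
    have "real a = real N * of_int k \<longleftrightarrow> real_of_int (int a) = real_of_int (int N * k)" for k
      by simp
    then show ?thesis by (simp only: of_int_eq_iff)
  qed
  also have "\<dots> \<longleftrightarrow> int N dvd int a" by (auto simp: dvd_def)
  finally show ?thesis by simp
qed

lemma norm_\<omega>_power [simp]: "cmod (\<omega> ^ a) = 1"
  by (simp add: \<omega>_def norm_power)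

lemma \<omega>_power_half: "\<omega> ^ (N div 2) = - 1"
proof -
  have "(\<omega> ^ (N div 2))\<^sup>2 = 1"
    using even_N by (simp add: \<omega>_power_eq_1_iff flip: power_mult)
  moreover have "\<omega> ^ (N div 2) \<noteq> 1"
    using N_pos even_N by (auto simp: \<omega>_power_eq_1_iff dest: dvd_imp_le)
  ultimately show ?thesis by (simp add: power2_eq_1_iff)
qed

lemma \<omega>_sum_eq_0:
  assumes "N dvd a * m" "\<not> N dvd a"
  shows "(\<Sum>j<m. \<omega> ^ (a * j)) = 0"
  using geometric_sum[of "\<omega> ^ a" m] assms
  by (simp add: \<omega>_power_eq_1_iff flip: power_mult)

definition h :: "nat \<Rightarrow> complex" where "h j = of_bool (Tr (g ^ j) = 0)"

text \<open>The character with exponent \<open>a\<close>, summed over the nonzero elements of trace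
  0 through their logarithms to base \<open>g\<close>.\<close>

definition kernel_sum :: "nat \<Rightarrow> complex" where
  "kernel_sum a = (\<Sum>j<N. h j * \<omega> ^ (a * j))"

text \<open>The bound \<open>(1 - 1/q) q ^ (n/2)\<close>, in a form free of real exponents.\<close>

definition R :: real where "R = (real q - 1) * sqrt (real q ^ (n - 2))"

lemma R_nonneg: "R \<ge> 0" using q_ge3 by (simp add: R_def)

lemma h_periodic: "h (j + N) = h j"
  by (simp add: h_def power_add g_power_N)

text \<open>For \<open>g ^ t\<close> in \<open>K\<close> the second trace condition follows from the
  first; otherwise \<open>card_common_kernel\<close> applies. The \<open>- 1\<close> removes
  \<open>u = 0\<close>.\<close>

lemma h_correlation:
  "(\<Sum>j<N. h j * h (j + t)) =
     of_nat (q ^ (n - 2)) - 1 + of_bool (Q dvd t) * of_nat (q ^ (n - 1) - q ^ (n - 2))"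
proof -
  let ?U = "{u. Tr u = 0 \<and> Tr (g ^ t * u) = 0}"
  have "card ?U = q ^ (n - 2) + of_bool (Q dvd t) * (q ^ (n - 1) - q ^ (n - 2))"
  proof (cases "Q dvd t")
    case True
    then have "?U = {u. Tr u = 0}"
      by (auto simp: Tr_scale g_power_in_K_iff)
    moreover have "q ^ (n - 2) \<le> q ^ (n - 1)" using q_ge3 by (intro power_increasing) auto
    ultimately show ?thesis using True Tr_range_and_kernel(2) by simp
  next
    case False
    then show ?thesis using card_common_kernel[of "g ^ t"] by (simp add: g_power_in_K_iff)
  qed
  moreover have "(\<Sum>j<N. h j * h (j + t)) = of_nat (card (?U - {0}))"
  proof -
    have "(\<Sum>j<N. h j * h (j + t)) = (\<Sum>j<N. of_bool (g ^ j \<in> ?U))"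
      by (intro sum.cong) (auto simp: h_def power_add mult.commute)
    also have "\<dots> = (\<Sum>u\<in>UNIV - {0}. of_bool (u \<in> ?U))"
      by (rule sum.reindex_bij_betw[OF bij_betw_g_power])
    also have "\<dots> = of_nat (card (?U - {0}))"
    proof -
      have "{u \<in> UNIV - {0}. u \<in> ?U} = ?U - {0}" by blast
      then show ?thesis by (subst sum_of_bool) simp_all
    qed
    finally show ?thesis .
  qed
  moreover have "of_nat (card (?U - {0})) = (of_nat (card ?U) - 1 :: complex)"
  proof -
    have "card ?U = Suc (card (?U - {0}))" by (rule card_Suc_Diff1[symmetric]) auto
    then show ?thesis by simp
  qed
  ultimately show ?thesis by simp
qed

text \<open>In the squared modulus, the constant part of the autocorrelation is killed by
  orthogonality. What remains is \<open>D\<close> times a sum of \<open>q - 1\<close> terms of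
  modulus 1, over the multiples of \<open>Q\<close>, and \<open>D * (q - 1)\<close> is the square of
  \<open>R\<close>.\<close>

lemma norm_kernel_sum_le:
  assumes "\<not> N dvd a"
  shows "cmod (kernel_sum a) \<le> R"
proof -
  define D :: complex where "D = of_nat (q ^ (n - 1) - q ^ (n - 2))"
  have per: "h (j + N) * \<omega> ^ (a * (j + N)) = h j * \<omega> ^ (a * j)" for j
  proof -
    have "\<omega> ^ (a * N) = 1" by (simp add: \<omega>_power_eq_1_iff)
    then show ?thesis by (simp add: h_periodic distrib_left power_add)
  qed
  have "cnj (kernel_sum a) = (\<Sum>j<N. h j * cnj (\<omega> ^ (a * j)))"
  proof -
    have "cnj (h j) = h j" for j by (simp add: h_def)
    then show ?thesis by (simp add: kernel_sum_def)
  qed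
  then have "kernel_sum a * cnj (kernel_sum a) =
      (\<Sum>j<N. kernel_sum a * (h j * cnj (\<omega> ^ (a * j))))"
    by (simp only: sum_distrib_left)
  also have "\<dots> = (\<Sum>j<N. \<Sum>t<N. \<omega> ^ (a * t) * (h j * h (j + t)))"
  proof (intro sum.cong refl)
    fix j
    have unit: "\<omega> ^ (a * j) * cnj (\<omega> ^ (a * j)) = 1"
      by (simp add: complex_norm_square[symmetric] del: power_mult complex_cnj_power)
    \<comment> \<open>Shifting the index by \<open>j\<close> over a full period produces the factor
      \<open>\<omega> ^ (a * j)\<close> that cancels its conjugate.\<close>
    have "kernel_sum a = (\<Sum>t<N. h (t + j) * \<omega> ^ (a * (t + j)))"
      unfolding kernel_sum_def by (rule periodic_sum_shift[symmetric]) (rule per)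
    then have "kernel_sum a * (h j * cnj (\<omega> ^ (a * j))) =
        (\<Sum>t<N. (h j * h (j + t)) * \<omega> ^ (a * t) * (\<omega> ^ (a * j) * cnj (\<omega> ^ (a * j))))"
      by (simp only: sum_distrib_right) (simp add: distrib_left power_add mult_ac add.commute del: complex_cnj_power)
    then show "kernel_sum a * (h j * cnj (\<omega> ^ (a * j))) =
        (\<Sum>t<N. \<omega> ^ (a * t) * (h j * h (j + t)))"
      unfolding unit by (simp add: mult_ac)
  qed
  also have "\<dots> = (\<Sum>t<N. \<omega> ^ (a * t) * (\<Sum>j<N. h j * h (j + t)))"
    by (subst sum.swap) (simp add: sum_distrib_left)
  also have "\<dots> = (\<Sum>t<N. (of_nat (q ^ (n - 2)) - 1) * \<omega> ^ (a * t) +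
                        D * (of_bool (Q dvd t) * \<omega> ^ (a * t)))"
    by (intro sum.cong refl) (simp only: h_correlation D_def, simp add: algebra_simps)
  also have "\<dots> = D * (\<Sum>t<N. of_bool (Q dvd t) * \<omega> ^ (a * t))"
    using \<omega>_sum_eq_0[of a N] assms by (simp add: sum.distrib flip: sum_distrib_left)
  finally have eq: "kernel_sum a * cnj (kernel_sum a) = D * (\<Sum>t<N. of_bool (Q dvd t) * \<omega> ^ (a * t))" .
  have "cmod (\<Sum>t<N. of_bool (Q dvd t) * \<omega> ^ (a * t)) \<le> (\<Sum>t<N. of_bool (Q dvd t))"
    by (rule order.trans[OF norm_sum], rule sum_mono) (simp add: norm_mult of_bool_def)
  also have "\<dots> = real (card {t. t < N \<and> Q dvd t})"
    by (simp add: of_bool_def sum.If_cases Int_def)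
  also have "\<dots> = real q - 1" using q_ge3 by (simp add: card_multiples_of_Q)
  finally have le: "cmod (\<Sum>t<N. of_bool (Q dvd t) * \<omega> ^ (a * t)) \<le> real q - 1" .
  have D: "cmod D = (real q - 1) * real q ^ (n - 2)"
  proof -
    have "q ^ (n - 1) - q ^ (n - 2) = (q - 1) * q ^ (n - 2)"
      unfolding q_power_n(2) by (simp add: diff_mult_distrib)
    then show ?thesis using q_ge3 by (simp only: D_def norm_of_nat) (simp add: of_nat_diff)
  qed
  have "(cmod (kernel_sum a))\<^sup>2 = cmod (kernel_sum a * cnj (kernel_sum a))"
    by (simp add: norm_mult power2_eq_square)
  also have "\<dots> \<le> ((real q - 1) * real q ^ (n - 2)) * (real q - 1)"
    unfolding eq norm_mult D using le q_ge3 by (intro mult_left_mono) auto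
  also have "\<dots> = R\<^sup>2" by (simp add: R_def power_mult_distrib) (simp add: power2_eq_square)
  finally show ?thesis using R_nonneg by (rule power2_le_imp_le)
qed

text \<open>As \<open>h\<close> takes only the values 0 and 1, this is the autocorrelation at shift
  0.\<close>

lemma kernel_sum_0: "kernel_sum 0 = of_nat (q ^ (n - 1)) - 1"
proof -
  have "kernel_sum 0 = (\<Sum>j<N. h j * h (j + 0))"
    by (auto simp: kernel_sum_def h_def intro: sum.cong)
  also have "\<dots> = of_nat (q ^ (n - 1)) - 1"
    using q_ge3 power_increasing[of "n - 2" "n - 1" q]
    by (simp only: h_correlation) (simp add: of_nat_diff)
  finally show ?thesis .
qed

text \<open>By \<open>\<omega>_power_half\<close>, the sign \<open>(- 1) ^ j\<close> is the
  quadratic character, with exponent \<open>N div 2\<close>.\<close>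

lemma square_kernel_sum:
  "(\<Sum>j<N. h (2 * j) * \<omega> ^ (2 * a * j)) = kernel_sum a + kernel_sum (a + N div 2)"
proof -
  obtain m where m: "N = 2 * m" using even_N by (elim evenE)
  let ?F = "\<lambda>j. h j * \<omega> ^ (a * j)"
  have "\<omega> ^ (a * N) = 1" by (simp add: \<omega>_power_eq_1_iff)
  then have "?F (j + N) = ?F j" for j
    by (simp add: h_periodic distrib_left power_add)
  then have "(\<Sum>j<N. ?F (2 * j)) = (\<Sum>j<N. ?F j) + (\<Sum>j<N. (- 1) ^ j * ?F j)"
    unfolding m by (rule sum_even_terms_periodic)
  also have "(\<Sum>j<N. (- 1) ^ j * ?F j) = kernel_sum (a + N div 2)"
    unfolding kernel_sum_def \<omega>_power_half[symmetric]
    by (simp add: algebra_simps power_add flip: power_mult)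
  finally show ?thesis by (simp add: kernel_sum_def mult_ac)
qed

section \<open>Sieving by primes\<close>

text \<open>Exponent 0 gives the count; the other exponents arise when a prime is added to
  \<open>P\<close>.\<close>

definition sieve_sum :: "nat set \<Rightarrow> nat \<Rightarrow> complex" where
  "sieve_sum P a = (\<Sum>j<N. of_bool (Tr (g ^ (2 * j)) = 0 \<and> (\<forall>p\<in>P. \<not> p dvd j)) * \<omega> ^ (a * j))"

definition sieve_count :: "nat set \<Rightarrow> nat" where
  "sieve_count P = card {j. j < N \<and> Tr (g ^ (2 * j)) = 0 \<and> (\<forall>p\<in>P. \<not> p dvd j)}"

lemma sieve_sum_0: "sieve_sum P 0 = of_nat (sieve_count P)"
proof -
  have "sieve_sum P 0 = (\<Sum>j<N. of_bool (Tr (g ^ (2 * j)) = 0 \<and> (\<forall>p\<in>P. \<not> p dvd j)))"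
    by (simp only: sieve_sum_def mult_0 power_0 mult_1_right)
  then show ?thesis by (simp only: sum_of_bool[OF finite_lessThan] sieve_count_def lessThan_iff)
qed

text \<open>Orthogonality for the \<open>p\<close> characters of order dividing \<open>p\<close>,
  whose exponents are the multiples of \<open>N div p\<close>.\<close>

lemma of_bool_dvd_eq_sum:
  assumes "p dvd N" "p > 0"
  shows "of_bool (p dvd j) = (\<Sum>b<p. \<omega> ^ (b * (N div p) * j)) / of_nat p"
proof -
  have N: "N = (N div p) * p" using assms by simp
  have "N div p > 0" using N N_pos by (cases "N div p") auto
  then have iff: "N dvd N div p * j \<longleftrightarrow> p dvd j"
    by (subst N) simp
  have "(\<Sum>b<p. \<omega> ^ (b * (N div p) * j)) = (\<Sum>b<p. \<omega> ^ (N div p * j * b))"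
    by (simp add: mult_ac)
  also have "\<dots> = of_nat p * of_bool (p dvd j)"
  proof (cases "p dvd j")
    case True
    then have "\<omega> ^ (N div p * j) = 1" by (simp add: \<omega>_power_eq_1_iff iff)
    then show ?thesis using True by (simp only: power_mult) simp
  next
    case False
    have "N div p * j * p = N * j" by (subst (2) N) (simp only: mult_ac)
    then have "N dvd N div p * j * p" by (simp only: dvd_triv_left)
    then have "(\<Sum>b<p. \<omega> ^ (N div p * j * b)) = 0" using False iff by (intro \<omega>_sum_eq_0) auto
    then show ?thesis using False by simp
  qed
  finally show ?thesis using assms by simp
qed

text \<open>The term \<open>b = 0\<close> of the average merges with the original sum into the
  factor \<open>1 - 1 / p\<close>.\<close>

lemma sieve_sum_insert:
  assumes "p dvd N" "p > 0"
  shows "sieve_sum (insert p P) a = (1 - 1 / of_nat p) * sieve_sum P a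
           - (\<Sum>b=1..<p. sieve_sum P (a + b * (N div p))) / of_nat p"
proof -
  define c :: "nat \<Rightarrow> complex" where
    "c = (\<lambda>j. of_bool (Tr (g ^ (2 * j)) = 0 \<and> (\<forall>p\<in>P. \<not> p dvd j)))"
  have S: "sieve_sum P a = (\<Sum>j<N. c j * \<omega> ^ (a * j))" for a
    by (simp only: sieve_sum_def c_def)
  have "sieve_sum (insert p P) a = (\<Sum>j<N. c j * \<omega> ^ (a * j) - c j * \<omega> ^ (a * j) * of_bool (p dvd j))"
    unfolding sieve_sum_def c_def by (intro sum.cong refl) auto
  also have "\<dots> = sieve_sum P a - (\<Sum>j<N. \<Sum>b<p. c j * \<omega> ^ ((a + b * (N div p)) * j) / of_nat p)"
    unfolding of_bool_dvd_eq_sum[OF assms] S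
    by (simp only: sum_subtractf sum_distrib_left sum_divide_distrib power_add distrib_right times_divide_eq_right mult.assoc)
  also have "\<dots> = sieve_sum P a - (\<Sum>b<p. sieve_sum P (a + b * (N div p))) / of_nat p"
    by (subst sum.swap) (simp only: S sum_divide_distrib)
  also have "{..<p} = insert 0 {1..<p}" using assms by auto
  also have "(\<Sum>b\<in>insert 0 {1..<p}. sieve_sum P (a + b * (N div p))) =
      sieve_sum P a + (\<Sum>b=1..<p. sieve_sum P (a + b * (N div p)))"
    by (subst sum.insert) auto
  finally show ?thesis by (simp add: algebra_simps add_divide_distrib)
qed

lemma Q_dvd_N: "Q dvd N" using N_eq by simp

text \<open>For the set of prime factors of \<open>k > 0\<close> this is \<open>theta k\<close>, by
  Euler's product.\<close>

definition \<theta> :: "nat set \<Rightarrow> real" where "\<theta> P = (\<Prod>p\<in>P. 1 - 1 / real p)"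

lemma \<theta>_pos:
  assumes "\<And>p. p \<in> P \<Longrightarrow> prime p"
  shows "\<theta> P > 0"
  unfolding \<theta>_def
proof (rule prod_pos)
  fix p assume "p \<in> P"
  then have "p > 1" using assms prime_gt_1_nat by blast
  then show "0 < 1 - 1 / real p" by simp
qed

text \<open>A character of order dividing \<open>M\<close> is multiplied by one of order exactly
  \<open>p\<close>, prime to \<open>M\<close>. The product has order dividing \<open>M * p\<close>
  and is nontrivial even if the first factor is trivial.\<close>

lemma nontrivial_shift:
  assumes "prime p" "p dvd Q" "\<not> p dvd M" "M dvd Q" "N dvd M * a" "b \<in> {1..<p}"
  shows "M * p dvd Q" "N dvd M * p * (a + b * (N div p))" "\<not> N dvd a + b * (N div p)"
proof -
  show "M * p dvd Q"
    using assms prime_imp_coprime[of p M] by (intro divides_mult) (auto simp: coprime_commute)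
  have p: "p dvd N" using assms(2) Q_dvd_N by (rule dvd_trans)
  have N: "N = p * (N div p)" using p by simp
  have eq: "M * p * (a + b * (N div p)) = p * (M * a) + M * b * N"
    by (subst (2) N) (simp only: distrib_left mult_ac)
  then show "N dvd M * p * (a + b * (N div p))" using assms(5) by simp
  show "\<not> N dvd a + b * (N div p)"
  proof
    assume "N dvd a + b * (N div p)"
    then have "N dvd M * a + M * b * (N div p)"
      by (metis dvd_mult distrib_left mult.assoc)
    then have "N dvd M * b * (N div p)" using assms(5) by (simp add: dvd_add_right_iff)
    then have "p * (N div p) dvd M * b * (N div p)" using N by simp
    moreover have "N div p > 0" using N N_pos by (cases "N div p") auto
    ultimately have "p dvd M * b" by simp
    then have "p dvd b" using assms(1,3) by (simp add: prime_dvd_mult_iff)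
    then show False using assms(6) by (auto dest: dvd_imp_le)
  qed
qed

text \<open>
  The hypotheses \<open>M dvd Q\<close> and \<open>N dvd M * a\<close> say that the order of the character with exponent \<open>a\<close>
  divides \<open>M\<close>, hence \<open>Q\<close>; as \<open>N / Q = q - 1\<close> is even, so is \<open>a\<close>.
\<close>

lemma norm_sieve_sum_empty_le:
  assumes "M dvd Q" "N dvd M * a" "\<not> N dvd a"
  shows "cmod (sieve_sum {} a) \<le> 2 * R"
proof -
  obtain M' where M': "Q = M * M'" using assms(1) by (elim dvdE)
  have "M > 0" using Q_pos M' by (cases M) auto
  have "M * (M' * (q - 1)) dvd M * a" using assms(2) by (simp add: N_eq M' mult.assoc)
  then have "M' * (q - 1) dvd a" using \<open>M > 0\<close> by simp
  moreover have "even (M' * (q - 1))" using q_odd by simp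
  ultimately have "even a" by (rule dvd_trans[rotated])
  then obtain b where a: "a = 2 * b" by (elim evenE)
  \<comment> \<open>The exponents \<open>b\<close> and \<open>b + N div 2\<close> give two square
    roots of the character; neither is trivial, since its square is not.\<close>
  have "\<not> N dvd b" using assms(3) a by auto
  moreover have "\<not> N dvd b + N div 2"
  proof
    assume "N dvd b + N div 2"
    then have "N dvd 2 * (b + N div 2)" by (rule dvd_mult)
    also have "2 * (b + N div 2) = a + N" using even_N a by simp
    finally show False using assms(3) by simp
  qed
  ultimately have "cmod (kernel_sum b + kernel_sum (b + N div 2)) \<le> R + R"
    by (intro order.trans[OF norm_triangle_ineq] add_mono norm_kernel_sum_le)
  moreover have "sieve_sum {} a = (\<Sum>j<N. h (2 * j) * \<omega> ^ (2 * b * j))"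
    by (simp add: sieve_sum_def h_def a)
  ultimately show ?thesis by (simp only: square_kernel_sum mult_2[of R])
qed

text \<open>Inserting \<open>p\<close> leaves two parts, each at most \<open>1 - 1 / p\<close> times
  the old bound: the scaled old sum, and \<open>p - 1\<close> twisted sums divided by
  \<open>p\<close>. The twists are covered by the induction hypothesis with \<open>M * p\<close> for
  \<open>M\<close>.\<close>

lemma norm_sieve_sum_le:
  assumes "finite P" "\<And>p. p \<in> P \<Longrightarrow> prime p \<and> p dvd Q \<and> \<not> p dvd M"
    and "M dvd Q" "N dvd M * a" "\<not> N dvd a"
  shows "cmod (sieve_sum P a) \<le> \<theta> P * 2 ^ card P * (2 * R)"
  using assms
proof (induction P arbitrary: M a rule: finite_induct)
  case empty
  then show ?case using norm_sieve_sum_empty_le by (simp add: \<theta>_def)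
next
  case (insert p P)
  define X where "X = \<theta> P * 2 ^ card P * (2 * R)"
  have p: "prime p" "p dvd Q" "\<not> p dvd M" using insert.prems(1) by auto
  have p1: "p > 1" using p(1) by (rule prime_gt_1_nat)
  have pN: "p dvd N" using p(2) Q_dvd_N by (rule dvd_trans)
  have a: "cmod (sieve_sum P a) \<le> X"
    unfolding X_def using insert.prems by (intro insert.IH) auto
  have shifts: "cmod (sieve_sum P (a + b * (N div p))) \<le> X" if b: "b \<in> {1..<p}" for b
    unfolding X_def
  proof (rule insert.IH)
    show "prime r \<and> r dvd Q \<and> \<not> r dvd M * p" if "r \<in> P" for r
      using insert.prems(1)[of r] insert.hyps(2) that p(1)
      by (auto simp: prime_dvd_mult_iff dest: primes_dvd_imp_eq)
  qed (use nontrivial_shift[OF p insert.prems(2,3) b] in auto)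
  have "cmod (sieve_sum (insert p P) a) \<le> cmod ((1 - 1 / of_nat p) * sieve_sum P a)
      + cmod ((\<Sum>b=1..<p. sieve_sum P (a + b * (N div p))) / of_nat p)"
    using p1 by (subst sieve_sum_insert[OF pN]) (auto intro: norm_triangle_ineq4)
  also have "cmod ((1 - 1 / of_nat p) * sieve_sum P a) \<le> (1 - 1 / real p) * X"
  proof -
    have "(1 - 1 / of_nat p :: complex) = of_real (1 - 1 / real p)" by simp
    then have "cmod (1 - 1 / of_nat p) = 1 - 1 / real p"
      using p1 by (simp only: norm_of_real) simp
    then show ?thesis using a p1 by (simp only: norm_mult) (intro mult_left_mono, auto)
  qed
  also have "cmod ((\<Sum>b=1..<p. sieve_sum P (a + b * (N div p))) / of_nat p) \<le> (1 - 1 / real p) * X"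
  proof -
    have "cmod (\<Sum>b=1..<p. sieve_sum P (a + b * (N div p))) \<le> (\<Sum>b=1..<p. X)"
      by (rule sum_norm_le) (rule shifts)
    also have "\<dots> = (real p - 1) * X" using p1 by (simp add: of_nat_diff)
    finally show ?thesis using p1 by (simp add: norm_divide field_simps)
  qed
  finally have "cmod (sieve_sum (insert p P) a) \<le> 2 * ((1 - 1 / real p) * X)" by (simp only: mult_2)
  also have "\<dots> = \<theta> (insert p P) * 2 ^ card (insert p P) * (2 * R)"
    using insert.hyps by (simp add: X_def \<theta>_def)
  finally show ?case .
qed

text \<open>This is \<open>sieve_sum_insert\<close> at exponent 0, where the \<open>p - 1\<close>
  twists are nontrivial characters of order \<open>p\<close>, bounded by
  \<open>norm_sieve_sum_le\<close> with \<open>M = p\<close>.\<close>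

lemma sieve_count_insert:
  assumes "finite P" "\<And>r. r \<in> P \<Longrightarrow> prime r \<and> r dvd Q" "prime p" "p dvd Q" "p \<notin> P"
  shows "real (sieve_count (insert p P)) \<ge>
    (1 - 1 / real p) * (real (sieve_count P) - \<theta> P * 2 ^ card P * (2 * R))"
proof -
  define X where "X = \<theta> P * 2 ^ card P * (2 * R)"
  define Y where "Y = (\<Sum>b=1..<p. sieve_sum P (0 + b * (N div p)))"
  have p1: "p > 1" using assms(3) by (rule prime_gt_1_nat)
  have pN: "p dvd N" using assms(4) Q_dvd_N by (rule dvd_trans)
  have "cmod Y \<le> (\<Sum>b=1..<p. X)"
    unfolding Y_def
  proof (rule sum_norm_le)
    fix b assume b: "b \<in> {1..<p}"
    have p_ndvd: "\<not> p dvd 1" using p1 by simp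
    show "cmod (sieve_sum P (0 + b * (N div p))) \<le> X"
      unfolding X_def
    proof (rule norm_sieve_sum_le[OF assms(1)])
      show "prime r \<and> r dvd Q \<and> \<not> r dvd 1 * p" if "r \<in> P" for r
        using that assms by (auto dest: primes_dvd_imp_eq)
    qed (use nontrivial_shift[OF assms(3,4) p_ndvd _ _ b, of 0] in auto)
  qed
  also have "\<dots> = (real p - 1) * X" using p1 by (simp add: of_nat_diff)
  finally have "Re Y \<le> (real p - 1) * X" using complex_Re_le_cmod[of Y] by linarith
  then have "Re Y / real p \<le> (1 - 1 / real p) * X" using p1 by (simp add: field_simps)
  moreover have "real (sieve_count (insert p P)) = (1 - 1 / real p) * real (sieve_count P) - Re Y / real p"
  proof -
    have "Re (sieve_sum (insert p P) 0) =
        Re (of_real (1 - 1 / real p) * of_real (real (sieve_count P)) - Y / of_real (real p))"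
      using p1 by (subst sieve_sum_insert[OF pN]) (simp_all add: sieve_sum_0 Y_def)
    then show ?thesis by (simp only: sieve_sum_0) (simp flip: of_real_mult)
  qed
  ultimately show ?thesis by (simp add: X_def right_diff_distrib)
qed

text \<open>For empty \<open>P\<close> the bracket is \<open>q ^ (n - 1) - 1 - R\<close>, from the
  trivial and the quadratic character. Each new prime subtracts a further
  \<open>2 ^ card P * (2 * R)\<close>; the summand \<open>+ R\<close> puts this geometric series in
  closed form.\<close>

lemma sieve_count_ge:
  assumes "finite P" "\<And>p. p \<in> P \<Longrightarrow> prime p \<and> p dvd Q"
  shows "real (sieve_count P) \<ge> \<theta> P * (real (q ^ (n - 1)) - 1 + R - 2 ^ card P * (2 * R))"
  using assms
proof (induction P rule: finite_induct)
  case empty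
  have "of_nat (sieve_count {}) = (\<Sum>j<N. h (2 * j) * \<omega> ^ (2 * 0 * j))"
    by (simp flip: sieve_sum_0 add: sieve_sum_def h_def)
  also have "\<dots> = of_nat (q ^ (n - 1)) - 1 + kernel_sum (0 + N div 2)"
    by (simp only: square_kernel_sum kernel_sum_0)
  finally have "real (sieve_count {}) = real (q ^ (n - 1)) - 1 + Re (kernel_sum (0 + N div 2))"
    by (metis Re_complex_of_real of_real_of_nat_eq complex_Re_of_nat plus_complex.sel(1) minus_complex.sel(1) one_complex.sel(1))
  moreover have "\<not> N dvd 0 + N div 2" using N_pos even_N by (auto dest: dvd_imp_le)
  then have "cmod (kernel_sum (0 + N div 2)) \<le> R" by (rule norm_kernel_sum_le)
  then have "Re (kernel_sum (0 + N div 2)) \<ge> - R"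
    using abs_Re_le_cmod[of "kernel_sum (0 + N div 2)"] by linarith
  ultimately show ?case by (simp add: \<theta>_def)
next
  case (insert p P)
  have p1: "p > 1" using insert.prems[of p] prime_gt_1_nat[of p] by simp
  define A where "A = real (q ^ (n - 1)) - 1 + R"
  have IH: "real (sieve_count P) \<ge> \<theta> P * (A - 2 ^ card P * (2 * R))"
    unfolding A_def using insert.prems by (intro insert.IH) auto
  have "\<theta> (insert p P) * (A - 2 ^ card (insert p P) * (2 * R)) =
      (1 - 1 / real p) * (\<theta> P * (A - 2 ^ card P * (2 * R)) - \<theta> P * 2 ^ card P * (2 * R))"
    using insert.hyps by (simp add: \<theta>_def algebra_simps)
  also have "\<dots> \<le> (1 - 1 / real p) * (real (sieve_count P) - \<theta> P * 2 ^ card P * (2 * R))"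
    using IH p1 by (intro mult_left_mono) auto
  also have "\<dots> \<le> real (sieve_count (insert p P))"
    using insert by (intro sieve_count_insert) auto
  finally show ?case by (simp add: A_def)
qed

text \<open>An exponent lost in passing from \<open>P\<close> to \<open>P \<union> S\<close> is
  already lost on adding a single prime of \<open>S\<close>, and \<open>sieve_count_insert\<close>
  bounds each such loss.\<close>

lemma sieve_count_Un_ge:
  assumes "finite P" "finite S" "P \<inter> S = {}" "\<And>p. p \<in> P \<union> S \<Longrightarrow> prime p \<and> p dvd Q"
  shows "real (sieve_count (P \<union> S)) \<ge>
     (1 - (\<Sum>p\<in>S. 1 / real p)) * real (sieve_count P)
       - (\<Sum>p\<in>S. 1 - 1 / real p) * (\<theta> P * 2 ^ card P * (2 * R))"
proof -
  define X where "X P = {j. j < N \<and> Tr (g ^ (2 * j)) = 0 \<and> (\<forall>p\<in>P. \<not> p dvd j)}" for P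
  have fin: "finite (X P)" for P by (simp add: X_def)
  have card: "sieve_count P = card (X P)" for P by (simp add: X_def sieve_count_def)
  have diff: "real (card (X P - X (insert p P))) = real (card (X P)) - real (card (X (insert p P)))" for p
  proof -
    have "X (insert p P) \<subseteq> X P" by (auto simp: X_def)
    then show ?thesis using fin by (simp add: card_Diff_subset card_mono of_nat_diff)
  qed
  have "X P \<subseteq> X (P \<union> S) \<union> (\<Union>p\<in>S. X P - X (insert p P))" by (auto simp: X_def)
  then have "card (X P) \<le> card (X (P \<union> S) \<union> (\<Union>p\<in>S. X P - X (insert p P)))"
    using fin assms(2) by (intro card_mono) auto
  also have "\<dots> \<le> card (X (P \<union> S)) + card (\<Union>p\<in>S. X P - X (insert p P))"
    by (rule card_Un_le)
  also have "card (\<Union>p\<in>S. X P - X (insert p P)) \<le> (\<Sum>p\<in>S. card (X P - X (insert p P)))"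
    by (rule card_UN_le[OF assms(2)])
  finally have "real (card (X P)) \<le>
      real (card (X (P \<union> S)) + (\<Sum>p\<in>S. card (X P - X (insert p P))))" by (simp only: of_nat_le_iff)
  then have "real (card (X P)) \<le>
      real (card (X (P \<union> S))) + (\<Sum>p\<in>S. real (card (X P)) - real (card (X (insert p P))))"
    by (simp add: diff)
  also have "(\<Sum>p\<in>S. real (card (X P)) - real (card (X (insert p P)))) \<le>
      (\<Sum>p\<in>S. 1 / real p * real (card (X P)) + (1 - 1 / real p) * (\<theta> P * 2 ^ card P * (2 * R)))"
  proof (rule sum_mono)
    fix p assume "p \<in> S"
    then have "real (sieve_count (insert p P)) \<ge>
        (1 - 1 / real p) * (real (sieve_count P) - \<theta> P * 2 ^ card P * (2 * R))"
      using assms by (intro sieve_count_insert) auto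
    then show "real (card (X P)) - real (card (X (insert p P))) \<le>
        1 / real p * real (card (X P)) + (1 - 1 / real p) * (\<theta> P * 2 ^ card P * (2 * R))"
      unfolding card by (simp add: algebra_simps)
  qed
  finally have "real (card (X P)) \<le> real (card (X (P \<union> S))) +
      ((\<Sum>p\<in>S. 1 / real p) * real (card (X P)) +
       (\<Sum>p\<in>S. 1 - 1 / real p) * (\<theta> P * 2 ^ card P * (2 * R)))"
    by (simp only: sum.distrib flip: sum_distrib_right)
  then show ?thesis unfolding card by (simp only: left_diff_distrib)
qed

section \<open>Counting free elements\<close>

lemma m_free_g_power_iff:
  assumes "m dvd N"
  shows "m_free m (g ^ j) \<longleftrightarrow> coprime j m"
proof
  assume free: "m_free m (g ^ j)"
  \<comment> \<open>The gcd serves as the exponent \<open>d\<close> in the definition of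
    freeness.\<close>
  have "g ^ j = (g ^ (j div gcd j m)) ^ gcd j m" by (simp flip: power_mult)
  then have "gcd j m = 1" using free unfolding m_free_def by (metis g_nonzero gcd_dvd2 power_not_zero)
  then show "coprime j m" by (simp only: coprime_iff_gcd_eq_1 not_False_eq_True)
next
  assume cop: "coprime j m"
  show "m_free m (g ^ j)"
    unfolding m_free_def
  proof (intro conjI allI impI)
    fix d z assume d: "d dvd m" "z \<noteq> 0" "g ^ j = z ^ d"
    obtain i where "z = g ^ i" using generator d(2) by blast
    then have "[j = i * d] (mod N)" using d(3) g_power_eq_iff by (simp flip: power_mult)
    then have "[j = i * d] (mod d)" using d(1) assms by (metis cong_dvd_modulus_nat dvd_trans)
    then have "d dvd j" using cong_dvd_iff dvd_triv_right by blast
    then show "d = 1" using cop d(1) coprime_common_divisor_nat by blast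
  qed simp
qed

lemma N0_eq_sieve_count:
  assumes "m dvd N"
  shows "N0 TYPE('a) q n m = sieve_count (prime_factors m)"
proof -
  have m: "m > 0" using assms N_pos by (cases m) auto
  let ?J = "{j. j < N \<and> Tr (g ^ (2 * j)) = 0 \<and> (\<forall>p\<in>prime_factors m. \<not> p dvd j)}"
  let ?X = "{x::'a. m_free m x \<and> Tr (x ^ 2) = 0}"
  have J: "j \<in> ?J \<longleftrightarrow> j < N \<and> g ^ j \<in> ?X" for j
  proof -
    have "(g ^ j)\<^sup>2 = g ^ (2 * j)" by (simp add: mult.commute flip: power_mult)
    then show ?thesis using coprime_iff_prime_factors[OF m] m_free_g_power_iff[OF assms] by auto
  qed
  have "(\<lambda>j. g ^ j) ` ?J = ?X"
  proof (intro equalityI subsetI)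
    fix x assume x: "x \<in> ?X"
    then have "x \<in> UNIV - {0}" by (simp add: m_free_def)
    then obtain j where "j < N" "x = g ^ j"
      using bij_betw_g_power by (auto simp: bij_betw_def)
    then show "x \<in> (\<lambda>j. g ^ j) ` ?J" using x J by blast
  qed (use J in blast)
  moreover have "inj_on (\<lambda>j. g ^ j) ?J"
    using bij_betw_imp_inj_on[OF bij_betw_g_power] by (rule inj_on_subset) auto
  ultimately have "bij_betw (\<lambda>j. g ^ j) ?J ?X"
    unfolding bij_betw_def by (intro conjI)
  from bij_betw_same_card[OF this] show ?thesis
    unfolding N0_def sieve_count_def by (rule sym)
qed

lemma N0_lower_bound:
  fixes p :: "nat \<Rightarrow> nat"
  assumes Q: "Q = k * (\<Prod>i=1..s. p i)"
    and inj: "inj_on p {1..s}"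
    and p: "\<And>i. i \<in> {1..s} \<Longrightarrow> prime (p i) \<and> p i dvd Q \<and> \<not> p i dvd k"
    and \<delta>: "\<delta> = 1 - (\<Sum>i=1..s. 1 / real (p i))" "\<delta> > 0"
  shows "real (N0 TYPE('a) q n Q) >
           \<delta> * theta k * real q powr (real n / 2) *
           (real q powr (real n / 2 - 1) - 2 * ((real s - 1) / \<delta> + 2) * real (W k))"
proof -
  define P where "P = prime_factors k"
  define S where "S = p ` {1..s}"
  define \<sigma> where "\<sigma> = (\<Sum>r\<in>S. 1 - 1 / real r)"
  define w where "w = (2::real) ^ card P"
  define c where "c = real (sieve_count P)"
  \<comment> \<open>This is \<open>q powr (n / 2 - 1)\<close>, so that
    \<open>R = (q - 1) * r\<close>.\<close>
  define r where "r = sqrt (real q ^ (n - 2))"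
  have k: "k > 0" using Q Q_pos by (cases k) auto
  have "k dvd Q" using Q by simp
  then have primes: "prime x \<and> x dvd Q" if "x \<in> P \<union> S" for x
    using that p by (auto simp: P_def S_def in_prime_factors_iff intro: dvd_trans)
  have factors: "prime_factors Q = P \<union> S"
  proof (intro equalityI subsetI)
    fix x assume "x \<in> prime_factors Q"
    then have x: "prime x" "x dvd k * (\<Prod>i=1..s. p i)" using Q by auto
    then consider "x dvd k" | i where "i \<in> {1..s}" "x dvd p i"
      by (auto simp: prime_dvd_mult_iff prime_dvd_prod_iff)
    then show "x \<in> P \<union> S"
    proof cases
      case 1
      then show ?thesis using x(1) k by (simp add: P_def in_prime_factors_iff)
    next
      case (2 i)
      then show ?thesis using x(1) p primes_dvd_imp_eq[of x "p i"] by (auto simp: S_def)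
    qed
  qed (use primes Q_pos in \<open>auto simp: in_prime_factors_iff\<close>)
  \<comment> \<open>Real subtraction matters for \<open>s = 0\<close>, where
    \<open>\<delta> = 1\<close> and \<open>\<sigma> = 0\<close>.\<close>
  have \<sigma>: "\<sigma> = real s - 1 + \<delta>"
    unfolding \<sigma>_def S_def sum.reindex[OF inj] \<delta>(1) by (simp add: sum_subtractf)
  have \<sigma>_nonneg: "\<sigma> \<ge> 0"
    unfolding \<sigma>_def
  proof (rule sum_nonneg)
    fix x assume "x \<in> S"
    then have "x > 1" using primes prime_gt_1_nat by blast
    then show "0 \<le> 1 - 1 / real x" by simp
  qed
  have \<delta>S: "1 - (\<Sum>x\<in>S. 1 / real x) = \<delta>"
    unfolding S_def sum.reindex[OF inj] \<delta>(1) by simp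
  have \<theta>: "theta k = \<theta> P" using k totient_formula2[of k] by (simp add: theta_def \<theta>_def P_def)
  have \<theta>_gt: "\<theta> P > 0" by (rule \<theta>_pos) (use primes in auto)
  have w: "w \<ge> 1" "w \<le> real (W k)"
    unfolding w_def P_def using card_prime_factors_le_W[OF k]
    by (auto simp flip: of_nat_le_iff)
  have "P \<inter> S = {}" using p by (auto simp: P_def S_def)
  then have N0: "real (N0 TYPE('a) q n Q) \<ge> \<delta> * c - \<sigma> * (\<theta> P * w * (2 * R))"
    using sieve_count_Un_ge[of P S] primes
    unfolding N0_eq_sieve_count[OF Q_dvd_N] factors c_def w_def \<sigma>_def \<delta>S
    by (simp add: P_def S_def)
  have "c \<ge> \<theta> P * (real (q ^ (n - 1)) - 1 + R - w * (2 * R))"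
    unfolding c_def w_def by (rule sieve_count_ge) (use primes in \<open>auto simp: P_def\<close>)
  moreover have r: "r \<ge> 1" "R = (real q - 1) * r" "real (q ^ (n - 1)) = real q * (r * r)"
  proof -
    show "r \<ge> 1" using q_ge3 by (simp add: r_def)
    show "R = (real q - 1) * r" by (simp add: R_def r_def)
    show "real (q ^ (n - 1)) = real q * (r * r)" unfolding q_power_n(2) by (simp add: r_def)
  qed
  moreover have "R \<ge> 1"
    unfolding r(2) using mult_mono[of 1 "real q - 1" 1 r] r(1) q_ge3 by simp
  ultimately have "c \<ge> \<theta> P * (real q * (r * r) - w * (2 * R))"
    using \<theta>_gt by (smt (verit) mult_left_mono)
  then have "\<delta> * c \<ge> \<delta> * (\<theta> P * (real q * (r * r) - w * (2 * R)))"
    using \<delta>(2) by (intro mult_left_mono) auto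
  with N0 have "real (N0 TYPE('a) q n Q) \<ge>
      \<theta> P * (\<delta> * (real q * (r * r)) - (\<delta> + \<sigma>) * (w * (2 * R)))"
    by (simp add: algebra_simps)
  \<comment> \<open>The strict inequality of the conclusion arises here, from
    \<open>R = (q - 1) * r < q * r\<close>.\<close>
  moreover have "w * (2 * R) < real (W k) * (2 * (real q * r))"
    using w r(1) q_ge3 \<open>R \<ge> 1\<close> by (intro mult_le_less_imp_less) (auto simp: r(2) algebra_simps)
  then have "(\<delta> + \<sigma>) * (w * (2 * R)) < (\<delta> + \<sigma>) * (real (W k) * (2 * (real q * r)))"
    using \<delta>(2) \<sigma>_nonneg by (intro mult_strict_left_mono) auto
  then have "\<theta> P * (\<delta> * (real q * (r * r)) - (\<delta> + \<sigma>) * (w * (2 * R))) >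
      \<theta> P * (\<delta> * (real q * (r * r)) - (\<delta> + \<sigma>) * (real (W k) * (2 * (real q * r))))"
    using \<theta>_gt by (intro mult_strict_left_mono) auto
  \<comment> \<open>Here
    \<open>(\<delta> + \<sigma>) / \<delta> = (s - 1) / \<delta> + 2\<close>.\<close>
  moreover have "\<theta> P * (\<delta> * (real q * (r * r)) - (\<delta> + \<sigma>) * (real (W k) * (2 * (real q * r)))) =
      \<delta> * \<theta> P * (real q * r) * (r - 2 * ((real s - 1) / \<delta> + 2) * real (W k))"
    using \<delta>(2) unfolding \<sigma> by (simp add: field_simps)
  moreover have powr: "real q powr (real n / 2 - 1) = r" "real q powr (real n / 2) = real q * r"
  proof -
    have "r = (real q powr real (n - 2)) powr (1 / 2)"
      using q_ge3 by (simp add: r_def powr_half_sqrt powr_realpow)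
    also have "\<dots> = real q powr (real n / 2 - 1)"
      using n_ge2 by (simp add: powr_powr of_nat_diff diff_divide_distrib)
    finally show *: "real q powr (real n / 2 - 1) = r" ..
    have "real q powr (real n / 2) = real q powr (1 + (real n / 2 - 1))" by simp
    also have "\<dots> = real q * r" unfolding powr_add * using q_ge3 by simp
    finally show "real q powr (real n / 2) = real q * r" .
  qed
  ultimately show ?thesis unfolding powr \<theta> by linarith
qed

lemma N0_pos_of_N0_Q_pos:
  assumes "N0 TYPE('a) q n Q > 0"
  shows "N0 TYPE('a) q n N > 0"
proof -
  have "{x::'a. m_free Q x \<and> Tr (x ^ 2) = 0} \<noteq> {}"
    using assms unfolding N0_def by (metis card.empty less_irrefl)
  then obtain x :: 'a where x: "m_free Q x" "Tr (x ^ 2) = 0" by auto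
  then have "x \<noteq> 0" by (simp add: m_free_def)
  then obtain j where j: "x = g ^ j" using generator by blast
  then have "coprime j Q" using x(1) m_free_g_power_iff[OF Q_dvd_N] by simp
  \<comment> \<open>Adding \<open>Q * i\<close> to the exponent multiplies \<open>x\<close> by an
    element of \<open>K\<close>, which scales \<open>Tr (x ^ 2)\<close> by the square of that
    element.\<close>
  then obtain i where i: "coprime (j + Q * i) N" using exists_coprime_shift N_pos by blast
  define y where "y = g ^ (j + Q * i)"
  have "m_free N y" unfolding y_def using i m_free_g_power_iff[of N] by simp
  moreover have "y ^ 2 = g ^ (Q * (2 * i)) * x ^ 2"
    by (simp add: y_def j algebra_simps flip: power_mult power_add)
  then have "Tr (y ^ 2) = 0" using x(2) by (simp add: Tr_scale g_power_in_K_iff)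
  ultimately show ?thesis unfolding N0_def by (auto simp: card_gt_0_iff)
qed

end

theorem theorem5p11:
  fixes q n k s Q :: nat and p :: "nat \<Rightarrow> nat" and \<delta> :: real
  assumes "primepow q" and "odd q" and "n \<ge> 3"
    and "CARD('a::{field, finite}) = q ^ n"
    and "even ((q ^ n - 1) div 2)"
    and "Q = (q ^ n - 1) div (q - 1)"
    and "Q = k * (\<Prod>i=1..s. p i)"
    and "inj_on p {1..s}"
    and "\<And>i. i \<in> {1..s} \<Longrightarrow> prime (p i) \<and> p i dvd Q \<and> \<not> p i dvd k"
    and "\<delta> = 1 - (\<Sum>i=1..s. 1 / real (p i))"
    and "\<delta> > 0"
  shows "real (N0 TYPE('a) q n Q) >
           \<delta> * theta k * real q powr (real n / 2) *
           (real q powr (real n / 2 - 1) - 2 * ((real s - 1) / \<delta> + 2) * real (W k))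
       \<and> (real q powr (real n / 2 - 1) > 2 * ((real s - 1) / \<delta> + 2) * real (W k)
           \<longrightarrow> N0 TYPE('a) q n (q ^ n - 1) > 0)"
proof -
  obtain g :: 'a where "\<And>x. x \<noteq> 0 \<longleftrightarrow> (\<exists>i::nat. x = g ^ i)"
    using finite_field_has_generator[where 'a = 'a] by auto
  then interpret F: finite_field_generator g q n
    using assms by unfold_locales auto
  have Q: "Q = F.Q" using assms(6) by (simp add: F.Q_def F.N_def)
  have bound: "real (N0 TYPE('a) q n Q) > \<delta> * theta k * real q powr (real n / 2) *
      (real q powr (real n / 2 - 1) - 2 * ((real s - 1) / \<delta> + 2) * real (W k))"
    unfolding Q by (rule F.N0_lower_bound) (use assms Q in auto)
  moreover have "N0 TYPE('a) q n (q ^ n - 1) > 0"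
    if "real q powr (real n / 2 - 1) > 2 * ((real s - 1) / \<delta> + 2) * real (W k)"
  proof -
    \<comment> \<open>Nonnegativity suffices because \<open>bound\<close> is strict.\<close>
    have "0 \<le> \<delta> * theta k * real q powr (real n / 2) *
        (real q powr (real n / 2 - 1) - 2 * ((real s - 1) / \<delta> + 2) * real (W k))"
      using that assms(11) by (simp add: theta_def)
    with bound have "N0 TYPE('a) q n Q > 0" by simp
    then show ?thesis using F.N0_pos_of_N0_Q_pos unfolding Q F.N_def by blast
  qed
  ultimately show ?thesis by blast
qed

end
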